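(* Let $V_2\subseteq\mathbb A^3$ be the affine surface $XZ=Y^2$, and let $\mathscr Y_{V_2}$ be its rational-ray visibility datum. Then $$\mathfrak d^{\mathrm{vis}}(\mathscr Y_{V_2})=0,\qquad \mathfrak d_p^{\mathrm{vis}}(\mathscr Y_{V_2})=1-\frac1p$$ for every prime $p$. Visibility is locally detectable (a branch point is globally visible if and only if it is $p$-adically visible for every prime $p$), and the Euler product $\prod_p\mathfrak d_p^{\mathrm{vis}}(\mathscr Y_{V_2})$ of the local densities agrees with the global density $\mathfrak d^{\mathrm{vis}}(\mathscr Y_{V_2})$.
   Context: Rational-ray datum of a homogeneous affine variety $V\subseteq\mathbb A^n$ over $\mathbb Q$: for every class $[v]\in(V(\mathbb Q)\cap\mathbb Q_{>0}^n)/\mathbb Q_{>0}$ choose a representative $v$ and take the ordered branch $\phi_{[v]}(t)=tv$, $t>0$. The branch locus is $\mathcal B=V(\mathbb Z)\cap\mathbb Z_{>0}^n$. For $P\in\mathbb Z^n$, $v_p(P)=\min_iv_p(P_i)$ and $H(P)=\max_i|P_i|$. A branch point $\phi_{[v]}(t)$ is globally visible if there is no real $s$ with $0<s<t$ and $\phi_{[v]}(s)\in\mathbb Z^n$; it is $p$-adically visible if $v_p(\phi_{[v]}(t))\le v_p(\phi_{[v]}(s))$ for all such $s$. $\mathfrak d^{\mathrm{vis}}$ (resp. $\mathfrak d_p^{\mathrm{vis}}$) is the limit as $X\to\infty$ of the proportion of globally visible (resp. $p$-adically visible) points among the points of $\mathcal B$ with $H\le X$. Infinite products over primes are limits of partial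 products over $p\le Y$ (the value $0$ is allowed). *)

theory Defs
  imports "HOL-Analysis.Analysis" "HOL-Computational_Algebra.Primes"
begin

text \<open>
  A homogeneous affine variety over the rationals in affine \<open>n\<close>-space is given by its set of real
  points, a subset \<open>V\<close> of \<open>real ^ 'n\<close>; rational and integral points are those points of \<open>V\<close> with
  coordinates in \<open>\<rat>\<close> resp. \<open>\<int>\<close>. Homogeneity (\<open>V\<close> is stable under positive scaling) is not part
  of the definitions below; see \<open>V2_scale\<close> for the cone considered here.
\<close>

definition of_int_vec :: "int ^ 'n \<Rightarrow> real ^ 'n" where
  "of_int_vec P = (\<chi> i. of_int (P $ i))"

definition pos_rational_points :: "(real ^ 'n) set \<Rightarrow> (real ^ 'n) set" where
  "pos_rational_points V = {v \<in> V. \<forall>i. v $ i \<in> \<rat> \<and> v $ i > 0}"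

definition ray_rel :: "(real ^ 'n) set \<Rightarrow> ((real ^ 'n) \<times> (real ^ 'n)) set" where
  "ray_rel V = {(v, w). v \<in> pos_rational_points V \<and> w \<in> pos_rational_points V \<and>
                        (\<exists>c\<in>\<rat>. c > 0 \<and> w = c *\<^sub>R v)}"

definition ray_classes :: "(real ^ 'n) set \<Rightarrow> (real ^ 'n) set set" where
  "ray_classes V = pos_rational_points V // ray_rel V"

text \<open>A rational-ray datum of \<open>V\<close> consists of a representative \<open>rep C\<close> in every class \<open>C\<close>;
  values of \<open>rep\<close> outside \<open>ray_classes V\<close> are irrelevant.\<close>

definition ray_datum :: "(real ^ 'n) set \<Rightarrow> ((real ^ 'n) set \<Rightarrow> real ^ 'n) \<Rightarrow> bool" where
  "ray_datum V rep \<longleftrightarrow> (\<forall>C\<in>ray_classes V. rep C \<in> C)"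

definition branch :: "((real ^ 'n) set \<Rightarrow> real ^ 'n) \<Rightarrow> (real ^ 'n) set \<Rightarrow> real \<Rightarrow> real ^ 'n" where
  "branch rep C t = t *\<^sub>R rep C"

definition branch_locus :: "(real ^ 'n) set \<Rightarrow> (int ^ 'n) set" where
  "branch_locus V = {P. of_int_vec P \<in> V \<and> (\<forall>i. P $ i > 0)}"

definition vp :: "nat \<Rightarrow> int \<Rightarrow> enat" where
  "vp p a = (if a = 0 then \<infinity> else enat (multiplicity (int p) a))"

definition vp_vec :: "nat \<Rightarrow> int ^ 'n \<Rightarrow> enat" where
  "vp_vec p P = Min (range (\<lambda>i. vp p (P $ i)))"

definition height :: "int ^ 'n \<Rightarrow> int" where
  "height P = Max (range (\<lambda>i. \<bar>P $ i\<bar>))"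

text \<open>\<open>branch_point V rep C t P\<close>: the parameter \<open>t > 0\<close> on the branch of the class \<open>C\<close> gives the
  point \<open>P\<close> of the branch locus.\<close>

definition branch_point ::
  "(real ^ 'n) set \<Rightarrow> ((real ^ 'n) set \<Rightarrow> real ^ 'n) \<Rightarrow> (real ^ 'n) set \<Rightarrow> real \<Rightarrow> int ^ 'n \<Rightarrow> bool" where
  "branch_point V rep C t P \<longleftrightarrow>
     C \<in> ray_classes V \<and> t > 0 \<and> P \<in> branch_locus V \<and> branch rep C t = of_int_vec P"

definition globally_visible ::
  "((real ^ 'n) set \<Rightarrow> real ^ 'n) \<Rightarrow> (real ^ 'n) set \<Rightarrow> real \<Rightarrow> bool" where
  "globally_visible rep C t \<longleftrightarrow>
     \<not> (\<exists>s. 0 < s \<and> s < t \<and> branch rep C s \<in> range of_int_vec)"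

definition p_adically_visible ::
  "((real ^ 'n) set \<Rightarrow> real ^ 'n) \<Rightarrow> nat \<Rightarrow> (real ^ 'n) set \<Rightarrow> real \<Rightarrow> bool" where
  "p_adically_visible rep p C t \<longleftrightarrow>
     (\<forall>s P Q. 0 < s \<and> s < t \<and> branch rep C t = of_int_vec P \<and> branch rep C s = of_int_vec Q
        \<longrightarrow> vp_vec p P \<le> vp_vec p Q)"

definition visible_points ::
  "(real ^ 'n) set \<Rightarrow> ((real ^ 'n) set \<Rightarrow> real ^ 'n) \<Rightarrow> (int ^ 'n) set" where
  "visible_points V rep = {P. \<exists>C t. branch_point V rep C t P \<and> globally_visible rep C t}"

definition p_visible_points ::
  "(real ^ 'n) set \<Rightarrow> ((real ^ 'n) set \<Rightarrow> real ^ 'n) \<Rightarrow> nat \<Rightarrow> (int ^ 'n) set" where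
  "p_visible_points V rep p = {P. \<exists>C t. branch_point V rep C t P \<and> p_adically_visible rep p C t}"

definition proportion :: "(int ^ 'n) set \<Rightarrow> (int ^ 'n) set \<Rightarrow> real \<Rightarrow> real" where
  "proportion S B X =
     real (card {P \<in> B. P \<in> S \<and> of_int (height P) \<le> X}) / real (card {P \<in> B. of_int (height P) \<le> X})"

text \<open>The densities are \<open>Lim\<close> values; that the limits exist has to be stated separately.\<close>

definition vis_density :: "(real ^ 'n) set \<Rightarrow> ((real ^ 'n) set \<Rightarrow> real ^ 'n) \<Rightarrow> real" where
  "vis_density V rep = Lim at_top (proportion (visible_points V rep) (branch_locus V))"

definition p_vis_density :: "(real ^ 'n) set \<Rightarrow> ((real ^ 'n) set \<Rightarrow> real ^ 'n) \<Rightarrow> nat \<Rightarrow> real" where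
  "p_vis_density V rep p = Lim at_top (proportion (p_visible_points V rep p) (branch_locus V))"

definition V2 :: "(real ^ 3) set" where
  "V2 = {v. v $ 1 * v $ 3 = (v $ 2)\<^sup>2}"

lemma V2_scale: "v \<in> V2 \<Longrightarrow> c *\<^sub>R v \<in> V2"
  by (simp add: V2_def power2_eq_square)

end

theory Submission
  imports Defs "HOL-Computational_Algebra.Nth_Powers" "HOL-Real_Asymp.Real_Asymp"
begin

text \<open>
  An integral point \<open>P\<close> of a ray is a multiple \<open>g P\<^sub>0\<close> of the primitive point of that ray, where \<open>g\<close> is the
  gcd of its coordinates. The integral points before it are \<open>k P\<^sub>0\<close> with \<open>1 \<le> k < g\<close>. Hence \<open>P\<close> is
  globally visible iff \<open>g = 1\<close>, and since \<open>P\<^sub>0\<close> has valuation \<open>0\<close>, it is visible at \<open>p\<close> iff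
  \<open>p\<close> does not divide \<open>g\<close>. Local detectability says that \<open>g = 1\<close> iff no prime divides \<open>g\<close>.

  The positive integral points of \<open>X Z = Y\<^sup>2\<close> are the points \<open>(d a\<^sup>2, d a b, d b\<^sup>2)\<close> with \<open>a, b\<close> coprime; such
  a point has gcd \<open>d\<close> and height \<open>d max(a, b)\<^sup>2\<close> (\<open>bij_betw_cone_point\<close>). Let \<open>S(x)\<close> be the sum of
  \<open>1 / max(a, b)\<^sup>2\<close> over the coprime pairs with \<open>max(a, b)\<^sup>2 \<le> x\<close>. The number \<open>N(x)\<close> of points of
  height at most \<open>x\<close> lies between \<open>x (S(x) - 1)\<close> and \<open>x S(x)\<close>, because there are at most \<open>x\<close> such pairs.
  The sum \<open>S(x)\<close> diverges, by comparison with the harmonic series (\<open>harm_le_weight_sum\<close>), whereas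
  \<open>S(x) - S(x / p) \<le> p\<close> (\<open>weight_sum_dilate\<close>).

  The two densities follow. There are at most \<open>x\<close> primitive points, against \<open>N(x) / x \<rightarrow> \<infinity>\<close>, so the
  global density is \<open>0\<close>. The points with \<open>p\<close> dividing \<open>d\<close> number \<open>N(x / p)\<close>, and
  \<open>N(x / p) / N(x) \<rightarrow> 1 / p\<close> by the two bounds on \<open>N\<close> and the slow variation of \<open>S\<close>, so the local
  density is \<open>1 - 1 / p\<close>. Finally the Euler product of the factors \<open>1 - 1 / p\<close> vanishes, because the product
  of their inverses over the primes up to \<open>Y\<close> dominates the harmonic sum up to \<open>Y\<close>
  (\<open>sum_smooth_inverse_le\<close>).
\<close>

section \<open>Visibility and the gcd of the coordinates\<close>

text \<open>
  The positive integral points on one ray are the multiples \<open>k P\<^sub>0\<close> of a primitive point, and \<open>k\<close> is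
  the greatest common divisor of the coordinates of \<open>k P\<^sub>0\<close>. All visibility conditions can be read
  off from this one number.
\<close>

definition coord_gcd :: "int ^ 'n \<Rightarrow> int" where
  "coord_gcd P = Gcd (range (($) P))"

lemma coord_gcd_dvd: "coord_gcd P dvd P $ i"
  by (simp add: coord_gcd_def)

lemma dvd_coord_gcd_iff: "k dvd coord_gcd P \<longleftrightarrow> (\<forall>i. k dvd P $ i)"
  by (auto simp: coord_gcd_def dvd_Gcd_iff)

lemma coord_gcd_nonneg: "coord_gcd P \<ge> 0"
  by (simp add: coord_gcd_def)

lemma coord_gcd_pos:
  assumes "P $ i > 0"
  shows "coord_gcd P > 0"
proof -
  have "coord_gcd P \<noteq> 0"
    using coord_gcd_dvd[of P i] assms by auto
  thus ?thesis using coord_gcd_nonneg[of P] by linarith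
qed

text \<open>
  The scalar \<open>u\<close> may be any nonnegative real: proportionality gives the integral identities
  \<open>P\<^sub>j Q\<^sub>i = Q\<^sub>j P\<^sub>i\<close>, and taking the greatest common divisor over \<open>i\<close> turns them into
  \<open>P\<^sub>j gcd Q = Q\<^sub>j gcd P\<close>, up to signs, with \<open>Q\<^sub>j = u P\<^sub>j\<close>.
\<close>

lemma coord_gcd_scale:
  assumes "of_int_vec Q = u *\<^sub>R of_int_vec P" "u \<ge> 0" "P $ j > 0"
  shows "real_of_int (coord_gcd Q) = u * of_int (coord_gcd P)"
proof -
  have Q: "real_of_int (Q $ i) = u * of_int (P $ i)" for i
    using arg_cong[OF assms(1), of "\<lambda>v. v $ i"] by (simp add: of_int_vec_def)
  have cross: "P $ j * Q $ i = Q $ j * P $ i" for i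
  proof -
    have "real_of_int (P $ j * Q $ i) = of_int (Q $ j * P $ i)"
      by (simp add: Q)
    thus ?thesis by linarith
  qed
  have "(*) (P $ j) ` range (($) Q) = (*) (Q $ j) ` range (($) P)"
    unfolding image_image using cross by simp
  hence "normalize (P $ j * coord_gcd Q) = normalize (Q $ j * coord_gcd P)"
    unfolding coord_gcd_def by (metis Gcd_mult)
  hence "\<bar>P $ j\<bar> * coord_gcd Q = \<bar>Q $ j\<bar> * coord_gcd P"
    using coord_gcd_nonneg[of P] coord_gcd_nonneg[of Q] by (simp add: abs_mult)
  hence "\<bar>real_of_int (P $ j)\<bar> * coord_gcd Q = \<bar>real_of_int (Q $ j)\<bar> * coord_gcd P"
    by (metis of_int_abs of_int_mult)
  hence "real_of_int (P $ j) * coord_gcd Q = real_of_int (P $ j) * (u * coord_gcd P)"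
    using assms(2,3) by (simp add: Q abs_mult)
  thus ?thesis using assms(3) by simp
qed

text \<open>
  The first integral point on the ray; it is the witness in every proof of invisibility.
\<close>

lemma primitive_part:
  assumes "P $ j > 0"
  obtains Q where "of_int_vec Q = (1 / of_int (coord_gcd P)) *\<^sub>R of_int_vec P" "coord_gcd Q = 1"
proof
  define Q where "Q = (\<chi> i. P $ i div coord_gcd P)"
  have c: "coord_gcd P > 0" using assms by (rule coord_gcd_pos)
  show Q: "of_int_vec Q = (1 / of_int (coord_gcd P)) *\<^sub>R of_int_vec P"
    using coord_gcd_dvd[of P]
    by (auto simp: vec_eq_iff of_int_vec_def Q_def real_of_int_div)
  have "real_of_int (coord_gcd Q) = 1 / of_int (coord_gcd P) * of_int (coord_gcd P)"
    by (rule coord_gcd_scale[OF Q _ assms]) (use c in simp)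
  thus "coord_gcd Q = 1" using c by simp
qed

text \<open>
  The primitive point comes first among the integral points of its branch and has valuation \<open>0\<close>.
  Visibility at \<open>p\<close> therefore comes down to whether the valuation vanishes.
\<close>

lemma vp_vec_eq_0_iff:
  assumes "prime p"
  shows "vp_vec p P = 0 \<longleftrightarrow> \<not> int p dvd coord_gcd P"
proof -
  have "vp p a = 0 \<longleftrightarrow> \<not> int p dvd a" for a
    using assms by (cases "a = 0")
      (auto simp: vp_def zero_enat_def prime_elem_multiplicity_eq_zero_iff)
  moreover have "vp_vec p P = 0 \<longleftrightarrow> (\<exists>i. vp p (P $ i) = 0)"
  proof -
    have "vp_vec p P \<le> 0 \<longleftrightarrow> (\<exists>i. vp p (P $ i) \<le> 0)"
      unfolding vp_vec_def by (subst Min_le_iff) auto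
    thus ?thesis by simp
  qed
  ultimately show ?thesis by (simp add: dvd_coord_gcd_iff)
qed

lemma branch_rescale:
  assumes "t > 0" "branch rep C t = of_int_vec P"
  shows "branch rep C s = (s / t) *\<^sub>R of_int_vec P"
  using assms by (simp add: branch_def flip: assms(2))

lemma branch_pointD:
  assumes "branch_point V rep C t P"
  shows "t > 0" "branch rep C t = of_int_vec P" "P $ i > 0" "P \<in> branch_locus V"
  using assms by (auto simp: branch_point_def branch_locus_def)

text \<open>
  If the gcd \<open>g\<close> of \<open>P\<close> exceeds \<open>1\<close>, the primitive point \<open>P / g\<close> lies strictly before \<open>P\<close>.
  Conversely, an integral point \<open>u P\<close> with \<open>0 < u < 1\<close> has gcd \<open>u g\<close>, and for \<open>g = 1\<close> this
  would be an integer strictly between \<open>0\<close> and \<open>1\<close>.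
\<close>

lemma globally_visible_iff_coord_gcd:
  assumes "branch_point V rep C t P"
  shows "globally_visible rep C t \<longleftrightarrow> coord_gcd P = 1"
proof -
  note bp = branch_pointD[OF assms]
  have c: "coord_gcd P > 0" by (rule coord_gcd_pos) (rule bp(3))
  show ?thesis
  proof
    assume vis: "globally_visible rep C t"
    show "coord_gcd P = 1"
    proof (rule ccontr)
      assume "coord_gcd P \<noteq> 1"
      hence c2: "coord_gcd P > 1" using c by simp
      obtain Q where "of_int_vec Q = (1 / of_int (coord_gcd P)) *\<^sub>R of_int_vec P"
        using primitive_part[OF bp(3)] by metis
      hence "branch rep C (t / of_int (coord_gcd P)) = of_int_vec Q"
        using branch_rescale[OF bp(1,2)] bp(1) by simp
      moreover have "0 < t / of_int (coord_gcd P)" "t / of_int (coord_gcd P) < t"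
        using bp(1) c2 by (auto simp: divide_simps)
      ultimately show False
        using vis unfolding globally_visible_def by (metis rangeI)
    qed
  next
    assume c1: "coord_gcd P = 1"
    show "globally_visible rep C t"
      unfolding globally_visible_def
    proof clarify
      fix s Q assume s: "0 < s" "s < t" "branch rep C s = of_int_vec Q"
      have "of_int_vec Q = (s / t) *\<^sub>R of_int_vec P"
        using branch_rescale[OF bp(1,2), of s] s by simp
      hence "real_of_int (coord_gcd Q) = s / t"
        using coord_gcd_scale[of Q "s / t" P] bp(1,3) s(1) c1 by simp
      moreover have "0 < s / t" "s / t < 1" using s by auto
      ultimately have "coord_gcd Q > 0" "coord_gcd Q < 1" by simp_all
      thus False by simp
    qed
  qed
qed

text \<open>
  If \<open>p\<close> divides the gcd \<open>g\<close> of \<open>P\<close>, then \<open>g > 1\<close> and the primitive point \<open>P / g\<close> is an earlier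
  point of smaller valuation. If \<open>p\<close> does not divide \<open>g\<close>, the valuation of \<open>P\<close> is \<open>0\<close> and hence
  minimal.
\<close>

lemma p_adically_visible_iff_coord_gcd:
  assumes "branch_point V rep C t P" "prime p"
  shows "p_adically_visible rep p C t \<longleftrightarrow> \<not> int p dvd coord_gcd P"
proof -
  note bp = branch_pointD[OF assms(1)]
  have inj: "P' = P" if "branch rep C t = of_int_vec P'" for P'
    using that bp(2) by (auto simp: of_int_vec_def vec_eq_iff)
  have c: "coord_gcd P > 0" by (rule coord_gcd_pos) (rule bp(3))
  show ?thesis
  proof
    assume "\<not> int p dvd coord_gcd P"
    hence "vp_vec p P = 0" using vp_vec_eq_0_iff[OF assms(2)] by blast
    thus "p_adically_visible rep p C t"
      unfolding p_adically_visible_def using inj by fastforce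
  next
    assume vis: "p_adically_visible rep p C t"
    show "\<not> int p dvd coord_gcd P"
    proof
      assume dvd: "int p dvd coord_gcd P"
      have p2: "p \<ge> 2" using assms(2) by (rule prime_ge_2_nat)
      have c2: "coord_gcd P > 1"
        using zdvd_imp_le[OF dvd c] p2 by linarith
      obtain Q where Q: "of_int_vec Q = (1 / of_int (coord_gcd P)) *\<^sub>R of_int_vec P" "coord_gcd Q = 1"
        using primitive_part[OF bp(3)] by metis
      have "branch rep C (t / of_int (coord_gcd P)) = of_int_vec Q"
        using branch_rescale[OF bp(1,2)] bp(1) Q by simp
      moreover have "0 < t / of_int (coord_gcd P)" "t / of_int (coord_gcd P) < t"
        using bp(1) c2 by (auto simp: divide_simps)
      ultimately have "vp_vec p P \<le> vp_vec p Q"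
        using vis bp(2) unfolding p_adically_visible_def by blast
      moreover have "vp_vec p Q = 0"
        using vp_vec_eq_0_iff[OF assms(2), of Q] Q(2) p2 by simp
      moreover have "vp_vec p P \<noteq> 0"
        using vp_vec_eq_0_iff[OF assms(2), of P] dvd by simp
      ultimately show False by simp
    qed
  qed
qed

lemma visibility_locally_detectable:
  assumes "branch_point V rep C t P"
  shows "globally_visible rep C t \<longleftrightarrow> (\<forall>p. prime p \<longrightarrow> p_adically_visible rep p C t)"
proof -
  have c: "coord_gcd P > 0" by (rule coord_gcd_pos) (rule branch_pointD(3)[OF assms])
  have "coord_gcd P = 1 \<longleftrightarrow> (\<forall>p. prime p \<longrightarrow> \<not> int p dvd coord_gcd P)"
  proof
    assume none: "\<forall>p. prime p \<longrightarrow> \<not> int p dvd coord_gcd P"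
    show "coord_gcd P = 1"
    proof (rule ccontr)
      assume "coord_gcd P \<noteq> 1"
      hence "nat (coord_gcd P) \<noteq> 1" using c by simp
      then obtain p where "prime p" "p dvd nat (coord_gcd P)"
        using prime_factor_nat by blast
      thus False using none c by (metis int_dvd_int_iff nat_0_le less_imp_le)
    qed
  qed (auto dest: prime_gt_1_nat)
  thus ?thesis
    using globally_visible_iff_coord_gcd[OF assms] p_adically_visible_iff_coord_gcd[OF assms] by simp
qed

text \<open>
  The sets of visible points are described by existence of a branch parameter, so each point of the
  branch locus must be known to lie on some branch.
\<close>

lemma branch_through_point:
  assumes "ray_datum V rep" "P \<in> branch_locus V"
  obtains C t where "branch_point V rep C t P"
proof -
  define v where "v = (of_int_vec P :: real ^ 'a)"
  define C where "C = ray_rel V `` {v}"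
  have v: "v \<in> pos_rational_points V"
    using assms(2) by (simp add: v_def branch_locus_def pos_rational_points_def of_int_vec_def)
  have C: "C \<in> ray_classes V"
    unfolding C_def ray_classes_def using v by (rule quotientI)
  hence "rep C \<in> C" using assms(1) by (simp add: ray_datum_def)
  then obtain c where c: "c > 0" "rep C = c *\<^sub>R v"
    by (auto simp: C_def ray_rel_def)
  have "branch_point V rep C (1 / c) P"
    using C assms(2) c by (simp add: branch_point_def branch_def v_def)
  thus thesis by (rule that)
qed

lemma visible_points_eq:
  assumes "ray_datum V rep"
  shows "visible_points V rep = {P \<in> branch_locus V. coord_gcd P = 1}"
proof (rule set_eqI)
  fix P
  show "P \<in> visible_points V rep \<longleftrightarrow> P \<in> {P \<in> branch_locus V. coord_gcd P = 1}"
    unfolding visible_points_def mem_Collect_eq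
    by (meson branch_through_point[OF assms] globally_visible_iff_coord_gcd branch_pointD(4))
qed

lemma p_visible_points_eq:
  assumes "ray_datum V rep" "prime p"
  shows "p_visible_points V rep p = {P \<in> branch_locus V. \<not> int p dvd coord_gcd P}"
proof (rule set_eqI)
  fix P
  show "P \<in> p_visible_points V rep p \<longleftrightarrow> P \<in> {P \<in> branch_locus V. \<not> int p dvd coord_gcd P}"
    unfolding p_visible_points_def mem_Collect_eq
    by (meson branch_through_point[OF assms(1)] p_adically_visible_iff_coord_gcd[OF _ assms(2)]
        branch_pointD(4))
qed

section \<open>Parametrization of the integral cone points\<close>

definition sqmax :: "nat \<times> nat \<Rightarrow> nat" where
  "sqmax q = (max (fst q) (snd q))\<^sup>2"

definition coprime_pairs :: "real \<Rightarrow> (nat \<times> nat) set" where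
  "coprime_pairs x = {q. fst q > 0 \<and> snd q > 0 \<and> coprime (fst q) (snd q) \<and> real (sqmax q) \<le> x}"

text \<open>
  The pair \<open>(a, b)\<close> determines the ray and \<open>d\<close> the position on it; the parameters are grouped as
  \<open>((a, b), d)\<close> so that summation over rays becomes a sum over a dependent product.
\<close>

definition cone_params :: "real \<Rightarrow> ((nat \<times> nat) \<times> nat) set" where
  "cone_params x = {(q, d). fst q > 0 \<and> snd q > 0 \<and> coprime (fst q) (snd q) \<and> d > 0 \<and>
     real (d * sqmax q) \<le> x}"

definition cone_point :: "(nat \<times> nat) \<times> nat \<Rightarrow> int ^ 3" where
  "cone_point = (\<lambda>((a, b), d). vector [int (d * a\<^sup>2), int (d * (a * b)), int (d * b\<^sup>2)])"

lemma height_cone_point: "height (cone_point (q, d)) = int (d * sqmax q)"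
proof -
  obtain a b where q: "q = (a, b)" by (cases q)
  have "height (cone_point (q, d)) = Max {int (d * a\<^sup>2), int (d * (a * b)), int (d * b\<^sup>2)}"
    by (simp add: q height_def cone_point_def UNIV_3 del: Max_insert)
  also have "\<dots> = int (d * (max a b)\<^sup>2)"
  proof (rule Max_eqI)
    have "d * a\<^sup>2 \<le> d * (max a b)\<^sup>2" "d * (a * b) \<le> d * (max a b)\<^sup>2" "d * b\<^sup>2 \<le> d * (max a b)\<^sup>2"
      by (auto simp: power2_eq_square intro!: mult_le_mono)
    thus "y \<le> int (d * (max a b)\<^sup>2)"
      if "y \<in> {int (d * a\<^sup>2), int (d * (a * b)), int (d * b\<^sup>2)}" for y
      using that by (metis insertE singletonD of_nat_le_iff)
  qed (auto simp: max_def)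
  finally show ?thesis by (simp add: q sqmax_def)
qed

lemma coord_gcd_cone_point:
  assumes "coprime (fst q) (snd q)"
  shows "coord_gcd (cone_point (q, d)) = int d"
proof -
  obtain a b where q: "q = (a, b)" by (cases q)
  have "coprime (int a ^ 2) (int b ^ 2)" using assms by (simp add: q)
  hence "gcd (int d * int a ^ 2) (int d * int b ^ 2) = int d"
    by (simp add: gcd_mult_distrib_int[symmetric] coprime_iff_gcd_eq_1)
  hence "coord_gcd (cone_point (q, d)) = gcd (int d) (int d * (int a * int b))"
    unfolding coord_gcd_def cone_point_def q UNIV_3
    by (simp add: gcd.left_commute gcd.commute)
  thus ?thesis by simp
qed

lemma inj_on_cone_point: "inj_on cone_point (cone_params x)"
proof (rule inj_onI)
  fix u v assume uv: "u \<in> cone_params x" "v \<in> cone_params x" "cone_point u = cone_point v"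
  obtain a b d a' b' d' where [simp]: "u = ((a, b), d)" "v = ((a', b'), d')"
    by (metis surj_pair)
  have "int d = int d'"
    using coord_gcd_cone_point[of "(a, b)" d] coord_gcd_cone_point[of "(a', b')" d'] uv
    by (simp add: cone_params_def)
  moreover have "cone_point u $ 1 = cone_point v $ 1" "cone_point u $ 3 = cone_point v $ 3"
    using uv(3) by simp_all
  hence "d * a\<^sup>2 = d' * a'\<^sup>2" "d * b\<^sup>2 = d' * b'\<^sup>2"
    unfolding cone_point_def by (simp_all del: of_nat_mult of_nat_power)
  ultimately show "u = v" using uv(1) by (simp add: cone_params_def)
qed

text \<open>
  After division by the gcd of \<open>x\<close> and \<open>z\<close>, the factors of the square \<open>y\<^sup>2\<close> are coprime, so each
  is a square.
\<close>

lemma square_times_coprime: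
  fixes x y z :: nat
  assumes "x * z = y\<^sup>2" "x > 0" "z > 0"
  obtains a b d where "x = d * a\<^sup>2" "y = d * (a * b)" "z = d * b\<^sup>2"
    "a > 0" "b > 0" "d > 0" "coprime a b"
proof -
  define d where "d = gcd x z"
  have d: "d > 0" using assms by (simp add: d_def)
  obtain x' z' where xz: "x = x' * d" "z = z' * d" "coprime x' z'"
    using gcd_coprime_exists[of x z] d unfolding d_def by auto
  have "d\<^sup>2 dvd y\<^sup>2"
    unfolding assms(1)[symmetric] xz by (simp add: power2_eq_square)
  then obtain y' where y: "y = d * y'" by auto
  have sq: "x' * z' = y'\<^sup>2"
    using assms(1) d unfolding xz y by (simp add: power2_eq_square)
  have pos: "x' > 0" "z' > 0" using assms xz by auto
  have "is_nth_power 2 (x' * z')" unfolding sq by (rule is_nth_powerI) simp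
  then obtain a b where ab: "x' = a\<^sup>2" "z' = b\<^sup>2"
    using is_nth_power_mult_coprime_nat_iff[OF xz(3), of 2] by (auto elim!: is_nth_powerE)
  have "(a * b)\<^sup>2 = y'\<^sup>2" using sq by (simp add: ab power_mult_distrib)
  hence "y' = a * b" by simp
  thus thesis
    using that[of d a b] xz y ab pos d by (auto simp: mult.commute)
qed

lemma bij_betw_cone_point:
  "bij_betw cone_point (cone_params x) {P \<in> branch_locus V2. of_int (height P) \<le> x}"
  unfolding bij_betw_def
proof (intro conjI inj_on_cone_point set_eqI iffI)
  fix P assume "P \<in> cone_point ` cone_params x"
  then obtain a b d where P: "P = cone_point ((a, b), d)" "((a, b), d) \<in> cone_params x" by auto
  have "real_of_int (height P) \<le> x"
    unfolding P(1) height_cone_point using P(2) by (simp add: cone_params_def)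
  thus "P \<in> {P \<in> branch_locus V2. of_int (height P) \<le> x}"
    using P by (auto simp: branch_locus_def V2_def of_int_vec_def forall_3 cone_point_def
        cone_params_def power2_eq_square)
next
  fix P assume "P \<in> {P \<in> branch_locus V2. of_int (height P) \<le> x}"
  hence P: "of_int_vec P \<in> V2" "\<And>i. P $ i > 0" "of_int (height P) \<le> x"
    by (auto simp: branch_locus_def)
  have "real_of_int (P $ 1 * P $ 3) = of_int ((P $ 2)\<^sup>2)"
    using P(1) by (simp add: V2_def of_int_vec_def)
  hence eq: "P $ 1 * P $ 3 = (P $ 2)\<^sup>2" by linarith
  have "nat (P $ 1) * nat (P $ 3) = (nat (P $ 2))\<^sup>2"
    using eq P(2) by (metis less_imp_le nat_mult_distrib nat_power_eq)
  then obtain a b d where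
    abd: "nat (P $ 1) = d * a\<^sup>2" "nat (P $ 2) = d * (a * b)" "nat (P $ 3) = d * b\<^sup>2"
      "a > 0" "b > 0" "d > 0" "coprime a b"
    using square_times_coprime P(2) by (metis zero_less_nat_eq)
  have coord: "P $ i = int (nat (P $ i))" for i using P(2)[of i] by simp
  have "P $ 1 = int (d * a\<^sup>2)" "P $ 2 = int (d * (a * b))" "P $ 3 = int (d * b\<^sup>2)"
    using coord[of 1] coord[of 2] coord[of 3] unfolding abd(1-3) .
  hence Pc: "P = cone_point ((a, b), d)"
    by (simp add: vec_eq_iff forall_3 cone_point_def)
  hence "((a, b), d) \<in> cone_params x"
    using P(3) abd unfolding Pc height_cone_point by (simp add: cone_params_def)
  thus "P \<in> cone_point ` cone_params x" using Pc by blast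
qed

section \<open>Counting cone points\<close>

lemma coprime_pairs_subset:
  assumes "x \<ge> 0"
  shows "coprime_pairs x \<subseteq> {1..nat \<lfloor>sqrt x\<rfloor>} \<times> {1..nat \<lfloor>sqrt x\<rfloor>}"
proof
  fix q assume q: "q \<in> coprime_pairs x"
  have le: "real (max (fst q) (snd q)) \<le> sqrt x"
    by (rule real_le_rsqrt) (use q in \<open>simp add: coprime_pairs_def sqmax_def\<close>)
  have "k \<le> nat \<lfloor>sqrt x\<rfloor>" if "k \<le> max (fst q) (snd q)" for k
    using that le by (simp add: le_nat_floor)
  hence "fst q \<le> nat \<lfloor>sqrt x\<rfloor>" "snd q \<le> nat \<lfloor>sqrt x\<rfloor>" by simp_all
  thus "q \<in> {1..nat \<lfloor>sqrt x\<rfloor>} \<times> {1..nat \<lfloor>sqrt x\<rfloor>}"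
    using q by (cases q) (auto simp: coprime_pairs_def)
qed

lemma finite_coprime_pairs: "finite (coprime_pairs x)"
proof (cases "x \<ge> 0")
  case True
  thus ?thesis using coprime_pairs_subset finite_subset by blast
next
  case False
  hence "coprime_pairs x = {}" by (auto simp: coprime_pairs_def)
  thus ?thesis by simp
qed

lemma card_coprime_pairs_le:
  assumes "x \<ge> 0"
  shows "real (card (coprime_pairs x)) \<le> x"
proof -
  define n where "n = nat \<lfloor>sqrt x\<rfloor>"
  have "card (coprime_pairs x) \<le> card ({1..n} \<times> {1..n})"
    unfolding n_def using assms by (intro card_mono coprime_pairs_subset) auto
  hence "real (card (coprime_pairs x)) \<le> real n * real n"
    by (simp add: card_cartesian_product flip: of_nat_mult)
  also have "\<dots> \<le> sqrt x * sqrt x"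
    using assms by (intro mult_mono) (auto simp: n_def)
  finally show ?thesis using assms by simp
qed

lemma sqmax_pos: "q \<in> coprime_pairs x \<Longrightarrow> real (sqmax q) > 0"
  by (auto simp: coprime_pairs_def sqmax_def)

text \<open>
  A ray with primitive point of height \<open>m\<close> contains \<open>\<lfloor>x / m\<rfloor>\<close> integral points of height at most
  \<open>x\<close>. Dropping the floor turns the number of points into \<open>x\<close> times the following sum.
\<close>

definition weight_sum :: "real \<Rightarrow> real" where
  "weight_sum x = (\<Sum>q\<in>coprime_pairs x. 1 / real (sqmax q))"

definition cone_count :: "real \<Rightarrow> real" where
  "cone_count x = real (card (cone_params x))"

lemma cone_params_eq_Sigma:
  "cone_params x = (SIGMA q:coprime_pairs x. {1..nat \<lfloor>x / real (sqmax q)\<rfloor>})"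
proof (rule set_eqI, clarify)
  fix a b d
  define m where "m = real (sqmax (a, b))"
  show "((a, b), d) \<in> cone_params x \<longleftrightarrow>
        ((a, b), d) \<in> (SIGMA q:coprime_pairs x. {1..nat \<lfloor>x / real (sqmax q)\<rfloor>})"
  proof (cases "a > 0 \<and> d > 0")
    case True
    hence m: "m > 0" by (simp add: m_def sqmax_def)
    have "d \<le> nat \<lfloor>x / m\<rfloor> \<longleftrightarrow> real d \<le> x / m" using True by linarith
    also have "\<dots> \<longleftrightarrow> real d * m \<le> x" using m by (simp add: field_simps)
    finally have 1: "d \<le> nat \<lfloor>x / m\<rfloor> \<longleftrightarrow> real d * m \<le> x" .
    have 2: "m \<le> x" if "real d * m \<le> x"
      using that mult_right_mono[of 1 "real d" m] True m by linarith
    show ?thesis using True 1 2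
      by (auto simp: cone_params_def coprime_pairs_def m_def)
  qed (auto simp: cone_params_def coprime_pairs_def)
qed

lemma cone_count_eq_sum:
  "cone_count x = (\<Sum>q\<in>coprime_pairs x. real (nat \<lfloor>x / real (sqmax q)\<rfloor>))"
  unfolding cone_count_def cone_params_eq_Sigma
  by (simp add: finite_coprime_pairs)

lemma finite_cone_params: "finite (cone_params x)"
  unfolding cone_params_eq_Sigma by (simp add: finite_coprime_pairs)

lemma cone_count_le:
  assumes "x \<ge> 0"
  shows "cone_count x \<le> x * weight_sum x"
  unfolding cone_count_eq_sum weight_sum_def sum_distrib_left
  using assms by (intro sum_mono) (simp add: of_nat_floor)

text \<open>
  Each floor loses at most \<open>1\<close>, and there are at most \<open>x\<close> rays, because \<open>a, b \<le> \<surd>x\<close>.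
\<close>

lemma cone_count_ge:
  assumes "x \<ge> 0"
  shows "cone_count x \<ge> x * (weight_sum x - 1)"
proof -
  have "x * weight_sum x - x \<le> (\<Sum>q\<in>coprime_pairs x. x / real (sqmax q)) - (\<Sum>q\<in>coprime_pairs x. 1)"
    using card_coprime_pairs_le[OF assms] by (simp add: weight_sum_def sum_distrib_left)
  also have "\<dots> = (\<Sum>q\<in>coprime_pairs x. x / real (sqmax q) - 1)"
    by (simp only: sum_subtractf)
  also have "\<dots> \<le> cone_count x"
    unfolding cone_count_eq_sum by (intro sum_mono) linarith
  finally show ?thesis by (simp add: algebra_simps)
qed

lemma weight_sum_mono:
  assumes "x \<le> y"
  shows "weight_sum x \<le> weight_sum y"
  unfolding weight_sum_def using assms
  by (intro sum_mono2 finite_coprime_pairs) (auto simp: coprime_pairs_def)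

text \<open>
  The pairs that enter between \<open>x / c\<close> and \<open>x\<close> number at most \<open>x\<close> and have weight at most \<open>c / x\<close>.
  Thus \<open>weight_sum\<close> varies slowly: its change under dilation is bounded while the sum itself
  diverges, so the ratio of its values at \<open>x / c\<close> and at \<open>x\<close> tends to \<open>1\<close>.
\<close>

lemma weight_sum_dilate:
  assumes "c \<ge> 1" "x > 0"
  shows "weight_sum x \<le> weight_sum (x / c) + c"
proof -
  have sub: "coprime_pairs (x / c) \<subseteq> coprime_pairs x"
    using assms divide_left_mono[of 1 c x] by (auto simp: coprime_pairs_def)
  have "weight_sum x - weight_sum (x / c)
        = (\<Sum>q\<in>coprime_pairs x - coprime_pairs (x / c). 1 / real (sqmax q))"
    unfolding weight_sum_def by (simp add: sum_diff sub finite_coprime_pairs)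
  also have "\<dots> \<le> (\<Sum>q\<in>coprime_pairs x - coprime_pairs (x / c). c / x)"
  proof (rule sum_mono)
    fix q assume q: "q \<in> coprime_pairs x - coprime_pairs (x / c)"
    hence "x / c < real (sqmax q)" by (auto simp: coprime_pairs_def)
    hence "1 / real (sqmax q) \<le> 1 / (x / c)"
      using assms sqmax_pos[of q x] q by (intro divide_left_mono mult_pos_pos) auto
    thus "1 / real (sqmax q) \<le> c / x" by simp
  qed
  also have "\<dots> \<le> real (card (coprime_pairs x)) * (c / x)"
    using assms card_mono[OF finite_coprime_pairs Diff_subset, of x "coprime_pairs (x / c)"]
    by (simp add: divide_right_mono mult_right_mono)
  also have "\<dots> \<le> x * (c / x)"
    using assms by (intro mult_right_mono card_coprime_pairs_le) auto
  finally show ?thesis using assms by simp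
qed

lemma sum_inverse_squares_le:
  assumes "n \<ge> 1"
  shows "(\<Sum>k=1..n. 1 / real k ^ 2) \<le> 2 - 1 / real n"
  using assms
proof (induction n rule: dec_induct)
  case (step n)
  have "1 / real (Suc n) ^ 2 \<le> 1 / (real n * real (Suc n))"
    using step.hyps by (intro divide_left_mono) (auto simp: power2_eq_square)
  also have "\<dots> = 1 / real n - 1 / real (Suc n)"
    using step.hyps by (simp add: field_simps)
  finally show ?case using step.IH step.hyps by simp
qed simp

text \<open>
  Summing \<open>1 / m\<^sup>2\<close> over all \<open>a \<le> m \<le> n\<close> gives the harmonic number. Every such pair is \<open>g\<close> times
  a coprime pair \<open>(a', m')\<close>, with \<open>1 / m\<^sup>2 = 1 / m'\<^sup>2 \<cdot> 1 / g\<^sup>2\<close>, so the sum is at most the weight of the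
  coprime pairs times \<open>\<Sum> 1 / g\<^sup>2 \<le> 2\<close>.
\<close>

lemma harm_le_weight_sum: "harm n \<le> 2 * weight_sum (real n ^ 2)"
proof (cases "n \<ge> 1")
  case True
  define T where "T = (SIGMA m:{1..n}. {1..m})"
  define decomp where "decomp = (\<lambda>(m::nat, a::nat). ((a div gcd a m, m div gcd a m), gcd a m))"
  have inj: "inj_on decomp T"
  proof (rule inj_onI, clarify)
    fix m a m' a' assume eq: "decomp (m, a) = decomp (m', a')"
    hence g: "gcd a m = gcd a' m'" by (simp add: decomp_def)
    have d: "a div gcd a m = a' div gcd a m" "m div gcd a m = m' div gcd a m"
      using eq unfolding decomp_def by (simp_all add: g)
    have "gcd a m dvd a" "gcd a m dvd m" "gcd a m dvd a'" "gcd a m dvd m'"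
      using gcd_dvd1[of a' m'] gcd_dvd2[of a' m'] unfolding g[symmetric] by auto
    thus "m = m' \<and> a = a'" using d dvd_div_eq_iff by blast
  qed
  have decomp: "fst (decomp (m, a)) \<in> coprime_pairs (real n ^ 2)"
      "snd (decomp (m, a)) \<in> {1..n}"
      "1 / real m ^ 2 = 1 / real (sqmax (fst (decomp (m, a)))) * (1 / real (snd (decomp (m, a))) ^ 2)"
    if "(m, a) \<in> T" for m a
  proof -
    have am: "1 \<le> a" "a \<le> m" "m \<le> n" using that by (auto simp: T_def)
    define g where "g = gcd a m"
    have "gcd a m \<noteq> 0" using am by simp
    then obtain a' m' where "a = a' * gcd a m" "m = m' * gcd a m" and cop: "coprime a' m'"
      using gcd_coprime_exists by blast
    hence a': "a = g * a'" and m': "m = g * m'" unfolding g_def by (metis mult.commute)+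
    have "g \<le> a" unfolding g_def using am by (intro gcd_le1_nat) auto
    hence "g \<le> n" using am by linarith
    moreover have "g > 0" using am by (simp add: g_def)
    ultimately have g: "g > 0" "g \<le> n" by simp_all
    have le: "a' \<le> m'" using am(2) g unfolding a' m' by simp
    have s: "decomp (m, a) = ((a', m'), g)"
    proof -
      have "gcd a m = g" by (simp add: g_def)
      moreover have "a div g = a'" "m div g = m'" using g(1) by (simp_all add: a' m')
      ultimately show ?thesis by (simp only: decomp_def prod.case)
    qed
    have sq: "sqmax (a', m') = m'\<^sup>2" using le by (simp add: sqmax_def max_absorb2)
    have "m' \<le> m" using g(1) unfolding m' by simp
    hence "m' \<le> n" using am(3) by simp
    hence "real m' ^ 2 \<le> real n ^ 2" by (intro power_mono) simp_all
    moreover have "a' \<noteq> 0" using am(1) unfolding a' by (intro notI) simp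
    ultimately show "fst (decomp (m, a)) \<in> coprime_pairs (real n ^ 2)"
      using le cop unfolding s coprime_pairs_def by (simp add: sq)
    show "snd (decomp (m, a)) \<in> {1..n}" using g unfolding s by simp
    show "1 / real m ^ 2 = 1 / real (sqmax (fst (decomp (m, a)))) * (1 / real (snd (decomp (m, a))) ^ 2)"
      unfolding s fst_conv snd_conv sq by (simp add: m' power_mult_distrib)
  qed
  \<comment> \<open>The weight of a pair as a function of its coprime part and its gcd.\<close>
  define f where "f = (\<lambda>(q, g). 1 / real (sqmax q) * (1 / real (g::nat) ^ 2))"
  have "harm n = (\<Sum>m=1..n. \<Sum>a=1..m. 1 / real m ^ 2)"
    by (simp add: harm_def power2_eq_square inverse_eq_divide)
  also have "\<dots> = (\<Sum>(m, a)\<in>T. 1 / real m ^ 2)"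
    unfolding T_def by (subst sum.Sigma) auto
  also have "\<dots> = (\<Sum>u\<in>T. f (decomp u))"
    using decomp(3) by (intro sum.cong) (auto simp: f_def case_prod_unfold)
  also have "\<dots> = sum f (decomp ` T)" by (simp add: sum.reindex[OF inj])
  also have "\<dots> \<le> sum f (coprime_pairs (real n ^ 2) \<times> {1..n})"
  proof (rule sum_mono2)
    show "decomp ` T \<subseteq> coprime_pairs (real n ^ 2) \<times> {1..n}"
    proof (rule image_subsetI)
      fix u assume "u \<in> T"
      thus "decomp u \<in> coprime_pairs (real n ^ 2) \<times> {1..n}"
        using decomp(1,2)[of "fst u" "snd u"] by (simp only: mem_Times_iff prod.collapse simp_thms)
    qed
  qed (auto simp: finite_coprime_pairs f_def)
  also have "\<dots> = weight_sum (real n ^ 2) * (\<Sum>g=1..n. 1 / real g ^ 2)"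
    by (simp add: f_def weight_sum_def sum_product sum.cartesian_product)
  also have "\<dots> \<le> weight_sum (real n ^ 2) * 2"
  proof (rule mult_left_mono)
    show "(\<Sum>g=1..n. 1 / real g ^ 2) \<le> 2"
      using sum_inverse_squares_le[OF True] by (smt (verit) of_nat_0_le_iff divide_nonneg_nonneg)
  qed (simp add: weight_sum_def sum_nonneg)
  finally show ?thesis by simp
qed (simp add: harm_def weight_sum_def sum_nonneg not_le)

lemma weight_sum_at_top: "filterlim weight_sum at_top at_top"
  unfolding filterlim_at_top
proof
  fix Z :: real
  have "\<forall>\<^sub>F n in sequentially. 2 * Z \<le> harm n"
    using harm_at_top unfolding filterlim_at_top by blast
  then obtain n where n: "2 * Z \<le> harm n" by (auto simp: eventually_sequentially)
  show "\<forall>\<^sub>F x in at_top. Z \<le> weight_sum x"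
    using eventually_ge_at_top[of "real n ^ 2"]
  proof eventually_elim
    case (elim x)
    show ?case using n harm_le_weight_sum[of n] weight_sum_mono[OF elim] by linarith
  qed
qed

section \<open>Densities of visible points\<close>

lemma card_cone_points:
  "card {P \<in> branch_locus V2. Q P \<and> of_int (height P) \<le> x} =
   card {u \<in> cone_params x. Q (cone_point u)}"
proof -
  have "{P \<in> branch_locus V2. Q P \<and> of_int (height P) \<le> x} =
        {P \<in> {P \<in> branch_locus V2. of_int (height P) \<le> x}. Q P}" by auto
  also have "\<dots> = cone_point ` {u \<in> cone_params x. Q (cone_point u)}"
    unfolding bij_betw_imp_surj_on[OF bij_betw_cone_point[of x], symmetric] by auto
  finally have "{P \<in> branch_locus V2. Q P \<and> of_int (height P) \<le> x} =
        cone_point ` {u \<in> cone_params x. Q (cone_point u)}" .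
  moreover have "inj_on cone_point {u \<in> cone_params x. Q (cone_point u)}"
    by (rule inj_on_subset[OF inj_on_cone_point]) auto
  ultimately show ?thesis by (simp add: card_image)
qed

lemma card_cone_locus: "real (card {P \<in> branch_locus V2. of_int (height P) \<le> x}) = cone_count x"
  using bij_betw_same_card[OF bij_betw_cone_point[of x]] by (simp add: cone_count_def)

lemma card_primitive_points:
  "card {u \<in> cone_params x. coord_gcd (cone_point u) = 1} = card (coprime_pairs x)"
proof -
  have "{u \<in> cone_params x. coord_gcd (cone_point u) = 1} = (\<lambda>q. (q, 1)) ` coprime_pairs x"
    by (auto simp: cone_params_def coprime_pairs_def coord_gcd_cone_point)
  moreover have "inj_on (\<lambda>q. (q, 1::nat)) (coprime_pairs x)" by (rule inj_onI) simp
  ultimately show ?thesis by (simp add: card_image)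
qed

text \<open>
  Division by \<open>p\<close> maps the points divisible by \<open>p\<close> bijectively onto all points and divides their
  heights by \<open>p\<close>. The local density at \<open>p\<close> is therefore determined by the growth of the total
  count under dilation.
\<close>

lemma card_multiples:
  assumes "p > 0"
  shows "real (card {u \<in> cone_params x. int p dvd coord_gcd (cone_point u)}) = cone_count (x / real p)"
proof -
  have "{u \<in> cone_params x. int p dvd coord_gcd (cone_point u)} =
        (\<lambda>(q, d). (q, p * d)) ` cone_params (x / real p)" (is "?L = ?f ` _")
  proof (rule set_eqI, clarify)
    fix a b d
    have "int p dvd int d \<longleftrightarrow> (\<exists>e. d = p * e)" by (auto simp: int_dvd_int_iff elim: dvdE)
    thus "((a, b), d) \<in> ?L \<longleftrightarrow> ((a, b), d) \<in> ?f ` cone_params (x / real p)"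
      using assms by (auto simp: cone_params_def coord_gcd_cone_point image_iff field_simps)
  qed
  moreover have "inj_on ?f (cone_params (x / real p))"
    using assms by (auto simp: inj_on_def)
  ultimately show ?thesis by (simp add: card_image cone_count_def)
qed

text \<open>
  At most \<open>x\<close> primitive points compete with at least \<open>x (weight_sum x - 1)\<close> points.
\<close>

lemma primitive_ratio_tendsto_0:
  "((\<lambda>x. real (card (coprime_pairs x)) / cone_count x) \<longlongrightarrow> 0) at_top"
proof (rule tendsto_sandwich)
  show "\<forall>\<^sub>F x in at_top. 0 \<le> real (card (coprime_pairs x)) / cone_count x"
    by (simp add: cone_count_def)
  have "\<forall>\<^sub>F x in at_top. weight_sum x > 1"
    using weight_sum_at_top filterlim_at_top_dense by blast
  thus "\<forall>\<^sub>F x in at_top. real (card (coprime_pairs x)) / cone_count x \<le> 1 / (weight_sum x - 1)"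
    using eventually_gt_at_top[of 0]
  proof eventually_elim
    case (elim x)
    have "real (card (coprime_pairs x)) / cone_count x \<le> x / (x * (weight_sum x - 1))"
      using elim card_coprime_pairs_le[of x] cone_count_ge[of x] by (intro frac_le) auto
    thus ?case using elim by simp
  qed
  have "((\<lambda>w::real. 1 / (w - 1)) \<longlongrightarrow> 0) at_top" by real_asymp
  thus "((\<lambda>x. 1 / (weight_sum x - 1)) \<longlongrightarrow> 0) at_top"
    using weight_sum_at_top by (rule filterlim_compose)
qed simp

text \<open>
  The counts at \<open>x / c\<close> and \<open>x\<close> are \<open>x / c\<close> and \<open>x\<close> times two weights that differ by bounded
  amounts and diverge, so only the factor \<open>1 / c\<close> survives in their ratio.
\<close>

lemma cone_count_dilate_ratio:
  assumes "c \<ge> 1"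
  shows "((\<lambda>x. cone_count (x / c) / cone_count x) \<longlongrightarrow> 1 / c) at_top"
proof (rule tendsto_sandwich)
  have ev: "\<forall>\<^sub>F x in at_top. weight_sum x > c + 1"
    using weight_sum_at_top filterlim_at_top_dense by blast
  show "\<forall>\<^sub>F x in at_top. (weight_sum x - c - 1) / (c * weight_sum x) \<le> cone_count (x / c) / cone_count x"
    using ev eventually_gt_at_top[of 0]
  proof eventually_elim
    case (elim x)
    have pos: "cone_count x > 0"
      using cone_count_ge[of x] elim assms mult_pos_pos[of x "weight_sum x - 1"] by linarith
    have "x / c * (weight_sum x - c - 1) \<le> x / c * (weight_sum (x / c) - 1)"
      using weight_sum_dilate[of c x] elim assms by (intro mult_left_mono) auto
    also have "\<dots> \<le> cone_count (x / c)" using elim assms by (intro cone_count_ge) auto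
    finally have "x / c * (weight_sum x - c - 1) / (x * weight_sum x) \<le> cone_count (x / c) / cone_count x"
      using elim assms cone_count_le[of x] pos by (intro frac_le) (auto simp: cone_count_def)
    moreover have "x / c * (weight_sum x - c - 1) / (x * weight_sum x) =
        (weight_sum x - c - 1) / (c * weight_sum x)"
      using elim by simp
    ultimately show ?case by simp
  qed
  show "\<forall>\<^sub>F x in at_top. cone_count (x / c) / cone_count x \<le> weight_sum x / (c * (weight_sum x - 1))"
    using ev eventually_gt_at_top[of 0]
  proof eventually_elim
    case (elim x)
    have "cone_count (x / c) \<le> x / c * weight_sum (x / c)"
      using elim assms by (intro cone_count_le) auto
    also have "\<dots> \<le> x / c * weight_sum x"
      using elim assms divide_left_mono[of 1 c x] by (intro mult_left_mono weight_sum_mono) auto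
    finally have "cone_count (x / c) / cone_count x \<le> x / c * weight_sum x / (x * (weight_sum x - 1))"
      using elim assms cone_count_ge[of x] by (intro frac_le) auto
    moreover have "x / c * weight_sum x / (x * (weight_sum x - 1)) =
        weight_sum x / (c * (weight_sum x - 1))"
      using elim by simp
    ultimately show ?case by simp
  qed
  have "((\<lambda>w::real. (w - c - 1) / (c * w)) \<longlongrightarrow> inverse c) at_top"
    using assms by real_asymp
  hence "((\<lambda>w::real. (w - c - 1) / (c * w)) \<longlongrightarrow> 1 / c) at_top"
    by (simp add: inverse_eq_divide)
  thus "((\<lambda>x. (weight_sum x - c - 1) / (c * weight_sum x)) \<longlongrightarrow> 1 / c) at_top"
    using weight_sum_at_top by (rule filterlim_compose)
  have "((\<lambda>w::real. w / (c * (w - 1))) \<longlongrightarrow> inverse c) at_top"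
    using assms by real_asymp
  hence "((\<lambda>w::real. w / (c * (w - 1))) \<longlongrightarrow> 1 / c) at_top"
    by (simp add: inverse_eq_divide)
  thus "((\<lambda>x. weight_sum x / (c * (weight_sum x - 1))) \<longlongrightarrow> 1 / c) at_top"
    using weight_sum_at_top by (rule filterlim_compose)
qed

lemma proportion_V2:
  "proportion S (branch_locus V2) x =
   real (card {P \<in> branch_locus V2. P \<in> S \<and> of_int (height P) \<le> x}) / cone_count x"
  by (simp add: proportion_def card_cone_locus)

lemma visible_proportion_tendsto:
  assumes "ray_datum V2 rep"
  shows "(proportion (visible_points V2 rep) (branch_locus V2) \<longlongrightarrow> 0) at_top"
proof -
  have "proportion (visible_points V2 rep) (branch_locus V2) x =
        real (card (coprime_pairs x)) / cone_count x" for x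
  proof -
    have "{P \<in> branch_locus V2. P \<in> visible_points V2 rep \<and> of_int (height P) \<le> x} =
          {P \<in> branch_locus V2. coord_gcd P = 1 \<and> of_int (height P) \<le> x}"
      using visible_points_eq[OF assms] by blast
    thus ?thesis by (simp add: proportion_V2 card_cone_points card_primitive_points)
  qed
  thus ?thesis using primitive_ratio_tendsto_0 by presburger
qed

lemma p_visible_proportion_tendsto:
  assumes "ray_datum V2 rep" "prime p"
  shows "(proportion (p_visible_points V2 rep p) (branch_locus V2) \<longlongrightarrow> 1 - 1 / real p) at_top"
proof -
  have p: "p > 0" using assms(2) by (rule prime_gt_0_nat)
  have card: "real (card {P \<in> branch_locus V2. P \<in> p_visible_points V2 rep p \<and> of_int (height P) \<le> x}) =
        cone_count x - cone_count (x / real p)" for x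
  proof -
    have "{P \<in> branch_locus V2. P \<in> p_visible_points V2 rep p \<and> of_int (height P) \<le> x} =
          {P \<in> branch_locus V2. \<not> int p dvd coord_gcd P \<and> of_int (height P) \<le> x}"
      using p_visible_points_eq[OF assms] by blast
    moreover have "{u \<in> cone_params x. \<not> int p dvd coord_gcd (cone_point u)} =
        cone_params x - {u \<in> cone_params x. int p dvd coord_gcd (cone_point u)}" by blast
    moreover have "card {u \<in> cone_params x. int p dvd coord_gcd (cone_point u)} \<le> card (cone_params x)"
      by (rule card_mono[OF finite_cone_params]) auto
    ultimately show ?thesis
      by (simp add: card_cone_points card_Diff_subset finite_cone_params of_nat_diff
          flip: card_multiples[OF p] cone_count_def)
  qed
  have lim: "((\<lambda>x. 1 - cone_count (x / real p) / cone_count x) \<longlongrightarrow> 1 - 1 / real p) at_top"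
    using p by (intro tendsto_diff tendsto_const cone_count_dilate_ratio) auto
  have "\<forall>\<^sub>F x in at_top. 1 < weight_sum x"
    using weight_sum_at_top filterlim_at_top_dense by blast
  hence "\<forall>\<^sub>F x in at_top. 1 - cone_count (x / real p) / cone_count x =
      proportion (p_visible_points V2 rep p) (branch_locus V2) x"
    using eventually_gt_at_top[of 0]
  proof eventually_elim
    case (elim x)
    have "cone_count x > 0"
      using cone_count_ge[of x] elim mult_pos_pos[of x "weight_sum x - 1"] by linarith
    thus ?case by (simp add: proportion_V2 card diff_divide_distrib)
  qed
  thus ?thesis using lim by (rule Lim_transform_eventually[rotated])
qed

section \<open>Vanishing of the Euler product\<close>

text \<open>
  Euler's inequality. Splitting off the power of one prime \<open>p\<close> embeds \<open>F\<close> into a product of an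
  initial segment of exponents and a set of numbers free of \<open>p\<close>; the exponents contribute
  a partial geometric series.
\<close>

lemma sum_smooth_inverse_le:
  assumes "finite A" "\<And>p. p \<in> A \<Longrightarrow> prime p" "finite F"
    "\<And>n. n \<in> F \<Longrightarrow> n > 0 \<and> (\<forall>q. prime q \<longrightarrow> q dvd n \<longrightarrow> q \<in> A)"
  shows "(\<Sum>n\<in>F. 1 / real n) \<le> (\<Prod>p\<in>A. 1 / (1 - 1 / real p))"
  using assms
proof (induction A arbitrary: F rule: finite_induct)
  case empty
  have "n = 1" if "n \<in> F" for n :: nat
  proof (rule ccontr)
    assume "n \<noteq> 1"
    then obtain q where "prime q" "q dvd n" using prime_factor_nat by blast
    thus False using empty(3) that by blast
  qed
  hence "F \<subseteq> {1}" by blast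
  hence "(\<Sum>n\<in>F. 1 / real n) \<le> (\<Sum>n\<in>{1}. 1 / real n)"
    by (intro sum_mono2) auto
  thus ?case by simp
next
  case (insert p A)
  have p: "prime p" using insert.prems by simp
  hence p2: "real p \<ge> 2" using prime_ge_2_nat by fastforce
  define rest where "rest n = n div p ^ multiplicity p n" for n
  define split where "split n = (multiplicity p n, rest n)" for n
  have prod: "n = p ^ multiplicity p n * rest n" for n
    unfolding rest_def by (simp add: multiplicity_dvd)
  have inj: "inj_on split F"
    by (rule inj_onI) (metis prod split_def prod.inject)
  obtain J where J: "\<And>n. n \<in> F \<Longrightarrow> multiplicity p n \<le> J"
    using finite_imageI[OF insert.prems(2), of "multiplicity p"]
    by (meson finite_nat_set_iff_bounded_le imageI)
  have IH: "(\<Sum>m\<in>rest ` F. 1 / real m) \<le> (\<Prod>p\<in>A. 1 / (1 - 1 / real p))"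
  proof (rule insert.IH)
    fix m assume "m \<in> rest ` F"
    then obtain n where n: "n \<in> F" "m = rest n" by blast
    have "n > 0" using insert.prems(3) n by blast
    hence "\<not> p dvd m" unfolding n rest_def
      using multiplicity_decompose[of n p] p by (auto simp: prime_nat_iff)
    moreover have "m > 0" using prod[of n] \<open>n > 0\<close> n(2) by (metis gr0I mult_0_right)
    moreover have "m dvd n" using prod[of n] n(2) by (metis dvd_triv_right)
    ultimately show "m > 0 \<and> (\<forall>q. prime q \<longrightarrow> q dvd m \<longrightarrow> q \<in> A)"
      using insert.prems(3)[OF n(1)] by (metis dvd_trans insertE)
  qed (use insert.prems in auto)
  have geo: "(\<Sum>j\<le>J. (1 / real p) ^ j) \<le> 1 / (1 - 1 / real p)"
  proof -
    have "(\<Sum>j\<le>J. (1 / real p) ^ j) = (1 - (1 / real p) ^ Suc J) / (1 - 1 / real p)"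
      using p2 by (subst sum_gp0) auto
    also have "\<dots> \<le> 1 / (1 - 1 / real p)"
      using p2 by (intro divide_right_mono) auto
    finally show ?thesis .
  qed
  have "(\<Sum>n\<in>F. 1 / real n) = (\<Sum>n\<in>F. case split n of (j, m) \<Rightarrow> (1 / real p) ^ j * (1 / real m))"
  proof (rule sum.cong)
    fix n assume "n \<in> F"
    show "1 / real n = (case split n of (j, m) \<Rightarrow> (1 / real p) ^ j * (1 / real m))"
      by (subst prod[of n]) (simp add: split_def power_one_over)
  qed simp
  also have "\<dots> = (\<Sum>(j, m)\<in>split ` F. (1 / real p) ^ j * (1 / real m))"
    by (simp add: sum.reindex[OF inj])
  also have "\<dots> \<le> (\<Sum>(j, m)\<in>{..J} \<times> rest ` F. (1 / real p) ^ j * (1 / real m))"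
    using J insert.prems(2) by (intro sum_mono2) (auto simp: split_def)
  also have "\<dots> = (\<Sum>j\<le>J. (1 / real p) ^ j) * (\<Sum>m\<in>rest ` F. 1 / real m)"
    by (simp add: sum_product sum.cartesian_product)
  also have "\<dots> \<le> 1 / (1 - 1 / real p) * (\<Prod>p\<in>A. 1 / (1 - 1 / real p))"
    using p2 by (intro mult_mono geo IH sum_nonneg) auto
  finally show ?case using insert.hyps by simp
qed

text \<open>
  The numbers up to \<open>Y\<close> have all their prime factors among the primes up to \<open>Y\<close>.
\<close>

lemma euler_product_le_inverse_harm:
  assumes "Y \<ge> 1"
  shows "(\<Prod>p | prime p \<and> real p \<le> Y. 1 - 1 / real p) \<le> 1 / harm (nat \<lfloor>Y\<rfloor>)"
proof -
  define n where "n = nat \<lfloor>Y\<rfloor>"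
  define A where "A = {p::nat. prime p \<and> real p \<le> Y}"
  have le_n: "real k \<le> Y \<longleftrightarrow> k \<le> n" for k
    using assms unfolding n_def by linarith
  have n: "n \<ge> 1" using le_n[of 1] assms by simp
  have fin: "finite A"
    by (rule finite_subset[of _ "{..n}"]) (auto simp: A_def le_n)
  have "harm n = (\<Sum>k=1..n. 1 / real k)" by (simp add: harm_def inverse_eq_divide)
  also have "\<dots> \<le> (\<Prod>p\<in>A. 1 / (1 - 1 / real p))"
  proof (rule sum_smooth_inverse_le[OF fin])
    fix k assume k: "k \<in> {1..n}"
    have "q \<in> A" if "prime q" "q dvd k" for q
      using dvd_imp_le[OF that(2)] k that(1) by (auto simp: A_def le_n)
    thus "k > 0 \<and> (\<forall>q. prime q \<longrightarrow> q dvd k \<longrightarrow> q \<in> A)" using k by auto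
  qed (auto simp: A_def)
  also have "\<dots> = 1 / (\<Prod>p\<in>A. 1 - 1 / real p)" by (simp add: prod_dividef)
  finally have h: "harm n \<le> 1 / (\<Prod>p\<in>A. 1 - 1 / real p)" .
  have "(\<Prod>p\<in>A. 1 - 1 / real p) > 0"
    by (intro prod_pos) (auto simp: A_def dest: prime_gt_1_nat)
  moreover have "harm n > (0::real)" using n by (simp add: harm_pos)
  ultimately show ?thesis using h
    unfolding n_def[symmetric] A_def[symmetric] by (simp add: field_simps)
qed

lemma euler_product_tendsto_0:
  "((\<lambda>Y. \<Prod>p | prime p \<and> real p \<le> Y. 1 - 1 / real p) \<longlongrightarrow> 0) at_top"
proof (rule tendsto_sandwich)
  show "\<forall>\<^sub>F Y in at_top. 0 \<le> (\<Prod>p | prime p \<and> real p \<le> Y. 1 - 1 / real p)"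
    by (intro always_eventually allI prod_nonneg) (auto dest: prime_gt_1_nat)
  show "\<forall>\<^sub>F Y in at_top. (\<Prod>p | prime p \<and> real p \<le> Y. 1 - 1 / real p) \<le> 1 / harm (nat \<lfloor>Y\<rfloor>)"
    using eventually_ge_at_top[of 1] by eventually_elim (rule euler_product_le_inverse_harm)
  have "filterlim (\<lambda>Y. harm (nat \<lfloor>Y\<rfloor>) :: real) at_top (at_top :: real filter)"
    by (rule filterlim_compose[OF harm_at_top
          filterlim_compose[OF filterlim_nat_sequentially filterlim_floor_sequentially]])
  thus "((\<lambda>Y::real. 1 / harm (nat \<lfloor>Y\<rfloor>) :: real) \<longlongrightarrow> 0) at_top"
    by (intro tendsto_divide_0[OF tendsto_const] filterlim_at_top_imp_at_infinity)
qed simp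

section \<open>The local-global comparison for the cone\<close>

theorem proposition4p10:
  fixes rep :: "(real ^ 3) set \<Rightarrow> real ^ 3"
  assumes "ray_datum V2 rep"
  shows "(proportion (visible_points V2 rep) (branch_locus V2) \<longlongrightarrow> vis_density V2 rep) at_top
    \<and> vis_density V2 rep = 0
    \<and> (\<forall>p. prime p \<longrightarrow>
         (proportion (p_visible_points V2 rep p) (branch_locus V2) \<longlongrightarrow> p_vis_density V2 rep p) at_top
         \<and> p_vis_density V2 rep p = 1 - 1 / real p)
    \<and> (\<forall>C t P. branch_point V2 rep C t P \<longrightarrow>
         (globally_visible rep C t \<longleftrightarrow> (\<forall>p. prime p \<longrightarrow> p_adically_visible rep p C t)))
    \<and> ((\<lambda>Y. \<Prod>p | prime p \<and> real p \<le> Y. p_vis_density V2 rep p) \<longlongrightarrow> vis_density V2 rep) at_top"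
proof -
  have vis: "vis_density V2 rep = 0"
    unfolding vis_density_def
    by (rule tendsto_Lim[OF _ visible_proportion_tendsto[OF assms]]) simp
  have pvis: "p_vis_density V2 rep p = 1 - 1 / real p" if "prime p" for p
    unfolding p_vis_density_def
    by (rule tendsto_Lim[OF _ p_visible_proportion_tendsto[OF assms that]]) simp
  have "(\<Prod>p | prime p \<and> real p \<le> Y. p_vis_density V2 rep p) =
        (\<Prod>p | prime p \<and> real p \<le> Y. 1 - 1 / real p)" for Y
    by (rule prod.cong) (auto simp: pvis)
  moreover have "\<forall>C t P. branch_point V2 rep C t P \<longrightarrow>
      (globally_visible rep C t \<longleftrightarrow> (\<forall>p. prime p \<longrightarrow> p_adically_visible rep p C t))"
    using visibility_locally_detectable by blast
  ultimately show ?thesis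
    using visible_proportion_tendsto[OF assms] p_visible_proportion_tendsto[OF assms]
      euler_product_tendsto_0
    by (simp add: vis pvis)
qed

end
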